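(* The assignment flow $$\dot W = R_W S(W),\qquad W(0)=\mathbf{1}_{\mathcal{W}},$$ is equivalent to the system $$\dot{W} = R_{W}\,\overline{S},\quad W(0)=\mathbf{1}_{\mathcal{W}},\qquad\qquad \dot{\overline{S}} = R_{\overline{S}}[\Omega^{\omega}\overline{S}],\quad \overline{S}(0)=S(\mathbf{1}_{\mathcal{W}}),$$ for curves $W(t),\overline{S}(t)\in\mathcal{W}$. That is, if $W(t)$ solves the assignment flow, then $(W(t),\overline{S}(t))$ with $\overline{S}(t)=S(W(t))$ solves the system; and conversely, if $(W(t),\overline{S}(t))$ solves the system, then $W(t)$ solves the assignment flow and $\overline S(t)=S(W(t))$.
   Context: Notation: $n,c\in\mathbb{N}$, $\mathcal{I}=\{1,\dots,n\}$, $\mathbf{1}_c=(1,\dots,1)^\top\in\mathbb{R}^c$. Products, quotients, exponentials and logarithms of vectors are componentwise, $\langle\cdot,\cdot\rangle$ is the Euclidean inner product. $\mathcal{S}=\{p\in\mathbb{R}^c : p_j>0\ \forall j,\ \langle \mathbf{1}_c,p\rangle=1\}$, $T_0=\{v\in\mathbb{R}^c:\langle\mathbf{1}_c,v\rangle=0\}$. $\mathcal{W}=\mathcal{S}\times\dots\times\mathcal{S}$ ($n$ factors), identified with the matrices $W\in\mathbb{R}^{n\times c}$ with rows $W_i\in\mathcal{S}$; $\mathbf{1}_{\mathcal{W}}\in\mathcal{W}$ is the barycenter, all of whose rows equal $\frac1c\mathbf{1}_c$. For $p\in\mathcal{S}$, $R_p=\operatorname{Diag}(p)-pp^\top:\mathbb{R}^c\to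 T_0$, and for $W\in\mathcal{W}$ the map $R_W$ on $\mathbb{R}^{n\times c}$ applies $R_{W_i}$ to the $i$-th row, for each $i$. For $p,q\in\mathcal{S}$, $v\in T_0$: $\operatorname{Exp}_p(v)=\frac{p e^{v/p}}{\langle p,e^{v/p}\rangle}$, $\operatorname{Exp}_p^{-1}(q)=R_p\log\frac{q}{p}$, and $\exp_p=\operatorname{Exp}_p\circ R_p$ (also applied to arguments in $\mathbb{R}^c$). Data: $(\mathcal{F},d_{\mathcal{F}})$ is a metric space, $f_1,\dots,f_n\in\mathcal{F}$, $f_1^*,\dots,f_c^*\in\mathcal{F}$, and $D_{\mathcal{F};i}=(d_{\mathcal{F}}(f_i,f_1^* ),\dots,d_{\mathcal{F}}(f_i,f_c^* ))^\top\in\mathbb{R}^c$, $i\in\mathcal{I}$. $\rho>0$ is fixed. Graph and weights: $\mathcal{G}=(\mathcal{I},\mathcal{E})$ is an undirected graph, $\mathcal{N}_i=\{k\in\mathcal{I}: ik\in\mathcal{E}\}\cup\{i\}$ (so $k\in\mathcal{N}_i\Leftrightarrow i\in\mathcal{N}_k$). Weights satisfy $\omega_{ik}>0$ for $k\in\mathcal{N}_i$ and $\sum_{k\in\mathcal{N}_i}\omega_{ik}=1$ for every $i$. The averaging matrix $\Omega^\omega\in\mathbb{R}^{n\times n}$ has entries $\Omega^\omega_{ij}=\omega_{ij}$ if $j\in\mathcal{N}_i$ and $\Omega^\omega_{ij}=0$ otherwise. Likelihood map: $L_i(W_i)=\exp_{W_i}(-\frac1\rho D_{\mathcal{F};i})=\frac{W_ie^{-D_{\mathcal{F};i}/\rho}}{\langle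 W_i,e^{-D_{\mathcal{F};i}/\rho}\rangle}$. Similarity map $S:\mathcal{W}\to\mathcal{W}$ with rows $S_i(W)=\operatorname{Exp}_{W_i}\big(\sum_{k\in\mathcal{N}_i}\omega_{ik}\operatorname{Exp}_{W_i}^{-1}(L_k(W_k))\big)$, $i\in\mathcal{I}$. *)

theory Defs
  imports "HOL-Analysis.Analysis"
begin

text \<open>Points of the simplex are vectors of type \<open>real ^ 'c\<close>, assignment matrices are of type
  \<open>real ^ 'c ^ 'n\<close>, with \<open>W $ i\<close> the \<open>i\<close>-th row.  The vector with all entries one is
  \<open>1 :: real ^ 'c\<close>.\<close>

definition simplex_interior :: "(real ^ 'c) set" where
  "simplex_interior = {p. (\<forall>j. p $ j > 0) \<and> 1 \<bullet> p = 1}"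

definition assignment_manifold :: "(real ^ 'c ^ 'n) set" where
  "assignment_manifold = {W. \<forall>i. W $ i \<in> simplex_interior}"

definition barycenter :: "real ^ 'c ^ 'n" where
  "barycenter = (\<chi> i j. 1 / real CARD('c))"

definition vexp :: "real ^ 'c \<Rightarrow> real ^ 'c" where
  "vexp v = (\<chi> j. exp (v $ j))"

definition vln :: "real ^ 'c \<Rightarrow> real ^ 'c" where
  "vln v = (\<chi> j. ln (v $ j))"

definition vdiv :: "real ^ 'c \<Rightarrow> real ^ 'c \<Rightarrow> real ^ 'c" where
  "vdiv v w = (\<chi> j. v $ j / w $ j)"

definition diag :: "real ^ 'c \<Rightarrow> real ^ 'c ^ 'c" where
  "diag p = (\<chi> j k. if j = k then p $ j else 0)"

definition replicator :: "real ^ 'c \<Rightarrow> real ^ 'c ^ 'c" where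
  "replicator p = diag p - (\<chi> j k. p $ j * p $ k)"

definition replicator_rows :: "real ^ 'c ^ 'n \<Rightarrow> real ^ 'c ^ 'n \<Rightarrow> real ^ 'c ^ 'n" where
  "replicator_rows W X = (\<chi> i. replicator (W $ i) *v (X $ i))"

text \<open>In \<open>Exp_map\<close>, as in \<open>HOL-Analysis\<close>, the product \<open>*\<close> of two vectors is componentwise.  The
  first arguments of the following maps are meant to be in the simplex; tangent vectors in
  \<open>Exp_map\<close> are meant to have component sum zero.\<close>

definition Exp_map :: "real ^ 'c \<Rightarrow> real ^ 'c \<Rightarrow> real ^ 'c" where
  "Exp_map p v = (1 / (p \<bullet> vexp (vdiv v p))) *\<^sub>R (p * vexp (vdiv v p))"

definition Exp_inv :: "real ^ 'c \<Rightarrow> real ^ 'c \<Rightarrow> real ^ 'c" where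
  "Exp_inv p q = replicator p *v vln (vdiv q p)"

definition lift_map :: "real ^ 'c \<Rightarrow> real ^ 'c \<Rightarrow> real ^ 'c" where
  "lift_map p v = Exp_map p (replicator p *v v)"

definition dist_vec :: "('f \<Rightarrow> 'f \<Rightarrow> real) \<Rightarrow> ('n \<Rightarrow> 'f) \<Rightarrow> ('c \<Rightarrow> 'f) \<Rightarrow> 'n \<Rightarrow> real ^ 'c" where
  "dist_vec d f fstar i = (\<chi> j. d (f i) (fstar j))"

definition nbhd :: "('n \<times> 'n) set \<Rightarrow> 'n \<Rightarrow> 'n set" where
  "nbhd E i = {k. (i, k) \<in> E} \<union> {i}"

definition avg_matrix :: "('n \<times> 'n) set \<Rightarrow> ('n \<Rightarrow> 'n \<Rightarrow> real) \<Rightarrow> real ^ 'n ^ 'n" where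
  "avg_matrix E \<omega> = (\<chi> i j. if j \<in> nbhd E i then \<omega> i j else 0)"

text \<open>In the next two definitions the data enter through the family \<open>D\<close> of distance vectors.\<close>

definition likelihood :: "real \<Rightarrow> ('n \<Rightarrow> real ^ 'c) \<Rightarrow> 'n \<Rightarrow> real ^ 'c \<Rightarrow> real ^ 'c" where
  "likelihood \<rho> D i p = lift_map p (- (1 / \<rho>) *\<^sub>R D i)"

definition similarity ::
    "real \<Rightarrow> ('n \<Rightarrow> real ^ 'c) \<Rightarrow> ('n \<times> 'n) set \<Rightarrow> ('n \<Rightarrow> 'n \<Rightarrow> real) \<Rightarrow> real ^ 'c ^ 'n \<Rightarrow> real ^ 'c ^ 'n"
  where
  "similarity \<rho> D E \<omega> W =
     (\<chi> i. Exp_map (W $ i)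
        (\<Sum>k\<in>nbhd E i. \<omega> i k *\<^sub>R Exp_inv (W $ i) (likelihood \<rho> D k (W $ k))))"

text \<open>Solutions are curves on a set \<open>T\<close> of times, intended to be an interval containing \<open>0\<close>;
  at an endpoint of \<open>T\<close> the derivative is one-sided.\<close>

definition assignment_flow_on ::
    "real set \<Rightarrow> (real ^ 'c ^ 'n \<Rightarrow> real ^ 'c ^ 'n) \<Rightarrow> (real \<Rightarrow> real ^ 'c ^ 'n) \<Rightarrow> bool" where
  "assignment_flow_on T S W \<longleftrightarrow>
     (\<forall>t\<in>T. W t \<in> assignment_manifold) \<and>
     (\<forall>t\<in>T. (W has_vector_derivative replicator_rows (W t) (S (W t))) (at t within T)) \<and>
     W 0 = barycenter"

definition S_flow_system_on ::
    "real set \<Rightarrow> (real ^ 'c ^ 'n \<Rightarrow> real ^ 'c ^ 'n) \<Rightarrow> real ^ 'n ^ 'n \<Rightarrow>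
     (real \<Rightarrow> real ^ 'c ^ 'n) \<Rightarrow> (real \<Rightarrow> real ^ 'c ^ 'n) \<Rightarrow> bool" where
  "S_flow_system_on T S \<Omega> W Sbar \<longleftrightarrow>
     (\<forall>t\<in>T. W t \<in> assignment_manifold \<and> Sbar t \<in> assignment_manifold) \<and>
     (\<forall>t\<in>T. (W has_vector_derivative replicator_rows (W t) (Sbar t)) (at t within T)) \<and>
     W 0 = barycenter \<and>
     (\<forall>t\<in>T. (Sbar has_vector_derivative replicator_rows (Sbar t) (\<Omega> ** Sbar t)) (at t within T)) \<and>
     Sbar 0 = S barycenter"

end

theory Submission
  imports Defs
begin

text \<open>In logarithmic coordinates, a replicator flow \<open>p' = R\<^bsub>p\<^esub> u\<close> reads \<open>(ln p)' = u\<close> modulo multiples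
  of the all-ones vector, and the softmax map inverts the componentwise logarithm modulo such
  multiples.  The rows of \<open>S(W)\<close> are the softmax of the rows of \<open>A(W) = \<Omega> (ln W - D / \<rho>)\<close>.
  If \<open>W' = R\<^bsub>W\<^esub> X\<close>, then \<open>A(W)' = \<Omega> X\<close> modulo constants in each row.  With \<open>X = S(W)\<close> the chain rule
  turns this into the equation for \<open>S(W)\<close>.  With \<open>X = Sbar\<close> it says that differences of entries
  in a row of \<open>ln Sbar - A(W)\<close> have derivative zero; they vanish at time \<open>0\<close>, hence always, and
  normalization gives \<open>Sbar = S(W)\<close>.\<close>

section \<open>Softmax and its invariance under constant shifts\<close>

definition softmax :: "real ^ 'c \<Rightarrow> real ^ 'c" where
  "softmax v = (\<chi> j. exp (v $ j) / (\<Sum>l\<in>UNIV. exp (v $ l)))"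

definition logits ::
    "real \<Rightarrow> ('n \<Rightarrow> real ^ 'c) \<Rightarrow> real ^ 'n ^ 'n \<Rightarrow> real ^ 'c ^ 'n \<Rightarrow> real ^ 'c ^ 'n" where
  "logits \<rho> D \<Omega> W = \<Omega> ** (\<chi> k. vln (W $ k) - (1 / \<rho>) *\<^sub>R D k)"

lemma sum_exp_pos: "(\<Sum>l\<in>UNIV. exp (v $ l :: real)) > 0" for v :: "real ^ 'c"
  by (intro sum_pos) auto

lemma softmax_pos: "softmax v $ j > 0"
  unfolding softmax_def using sum_exp_pos[of v] by simp

lemma softmax_in_simplex: "softmax v \<in> simplex_interior"
  using sum_exp_pos[of v] softmax_pos[of v]
  by (simp add: simplex_interior_def inner_vec_def softmax_def flip: sum_divide_distrib)

text \<open>Exponentiating gives a multiple \<open>exp c\<close> of the componentwise exponential of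
  \<open>v\<close>, and component sum one forces \<open>exp c\<close> to be the reciprocal of the
  normalizer.\<close>

lemma softmax_eqI:
  assumes p: "p \<in> simplex_interior" and c: "\<And>j. vln p $ j = v $ j + c"
  shows "p = softmax v"
proof -
  have e: "p $ j = exp c * exp (v $ j)" for j
    using p c[of j]
    by (metis (mono_tags, lifting) exp_add exp_ln mem_Collect_eq mult.commute simplex_interior_def vec_lambda_beta vln_def)
  have "(\<Sum>l\<in>UNIV. p $ l) = 1"
    using p by (simp add: simplex_interior_def inner_vec_def)
  then have "exp c * (\<Sum>l\<in>UNIV. exp (v $ l)) = 1"
    by (simp add: e sum_distrib_left)
  then have "exp c = 1 / (\<Sum>l\<in>UNIV. exp (v $ l))"
    using sum_exp_pos[of v] by (simp add: field_simps)
  then show ?thesis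
    by (simp add: vec_eq_iff softmax_def e)
qed

lemma vln_softmax: "vln (softmax v) $ j = v $ j - ln (\<Sum>l\<in>UNIV. exp (v $ l))"
  using sum_exp_pos[of v] by (simp add: vln_def softmax_def ln_div)

lemma softmax_cong:
  assumes "\<And>j. v $ j = w $ j + c"
  shows "softmax v = softmax w"
  by (rule softmax_eqI[OF softmax_in_simplex, where c = "c - ln (\<Sum>l\<in>UNIV. exp (v $ l))"])
    (simp add: vln_softmax assms)

section \<open>The lifting and similarity maps in softmax form\<close>

lemma replicator_mult: "(replicator p *v u) $ j = p $ j * (u $ j - p \<bullet> u)"
proof -
  have "(replicator p *v u) $ j = (\<Sum>k\<in>UNIV. (if k = j then p $ j * u $ j else 0) - p $ j * (p $ k * u $ k))"
    unfolding replicator_def diag_def matrix_vector_mult_def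
    by (auto intro!: sum.cong simp: algebra_simps)
  also have "\<dots> = p $ j * u $ j - p $ j * (p \<bullet> u)"
    by (simp add: sum_subtractf inner_vec_def sum_distrib_left)
  finally show ?thesis
    by (simp add: algebra_simps)
qed

text \<open>Dividing \<open>replicator p *v v\<close> by \<open>p\<close> leaves \<open>v\<close>
  minus the constant \<open>p \<bullet> v\<close>, and softmax ignores this constant.\<close>

lemma lift_map_softmax:
  assumes p: "p \<in> simplex_interior"
  shows "lift_map p v = softmax (vln p + v)"
proof -
  have pos: "p $ j > 0" for j
    using p by (simp add: simplex_interior_def)
  define w where "w = vdiv (replicator p *v v) p"
  have w: "w $ j = v $ j - p \<bullet> v" for j
    using pos[of j] by (simp add: w_def vdiv_def replicator_mult)
  have "lift_map p v = softmax (vln p + w)"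
    using pos by (simp add: lift_map_def Exp_map_def softmax_def vec_eq_iff vexp_def vln_def
        inner_vec_def exp_add flip: w_def)
  also have "\<dots> = softmax (vln p + v)"
    by (rule softmax_cong[where c = "- (p \<bullet> v)"]) (simp add: w)
  finally show ?thesis .
qed

lemma avg_matrix_mult:
  "(avg_matrix E \<omega> ** X) $ i $ j = (\<Sum>k\<in>nbhd E i. \<omega> i k * X $ k $ j)"
  for X :: "real ^ 'c ^ 'n::finite"
proof -
  have "(avg_matrix E \<omega> ** X) $ i $ j = (\<Sum>k\<in>UNIV. if k \<in> nbhd E i then \<omega> i k * X $ k $ j else 0)"
    unfolding avg_matrix_def matrix_matrix_mult_def by (auto intro!: sum.cong)
  then show ?thesis
    by (simp add: sum.If_cases)
qed

text \<open>Each \<open>Exp_inv\<close> term is the replicator matrix of \<open>W $ i\<close>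
  applied to a logarithm. By linearity the weighted sum is again of this form, so the row is a value
  of \<open>lift_map\<close>.\<close>

lemma similarity_softmax:
  fixes W :: "real ^ 'c ^ 'n::finite"
  assumes W: "W \<in> assignment_manifold" and sum: "(\<Sum>k\<in>nbhd E i. \<omega> i k) = 1"
  shows "similarity \<rho> D E \<omega> W $ i = softmax (logits \<rho> D (avg_matrix E \<omega>) W $ i)"
proof -
  have Wi: "W $ k \<in> simplex_interior" for k
    using W by (simp add: assignment_manifold_def)
  have pos: "W $ k $ j > 0" for k j
    using Wi by (simp add: simplex_interior_def)
  define u where "u k = vln (W $ k) - (1 / \<rho>) *\<^sub>R D k" for k
  define c where "c k = ln (\<Sum>l\<in>UNIV. exp (u k $ l))" for k
  have L: "likelihood \<rho> D k (W $ k) = softmax (u k)" for k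
    by (simp add: likelihood_def lift_map_softmax[OF Wi] u_def)
  have "similarity \<rho> D E \<omega> W $ i =
      lift_map (W $ i) (\<Sum>k\<in>nbhd E i. \<omega> i k *\<^sub>R vln (vdiv (softmax (u k)) (W $ i)))"
    by (simp add: similarity_def Exp_inv_def L lift_map_def vec.sum vector_scalar_commute
        flip: scalar_mult_eq_scaleR)
  also have "\<dots> = softmax (vln (W $ i) + (\<Sum>k\<in>nbhd E i. \<omega> i k *\<^sub>R vln (vdiv (softmax (u k)) (W $ i))))"
    by (rule lift_map_softmax[OF Wi])
  also have "\<dots> = softmax (logits \<rho> D (avg_matrix E \<omega>) W $ i)"
  \<comment> \<open>The log normalizers \<open>c k\<close> of the likelihoods do not depend on the
    column, so their weighted mean is a mere shift.\<close>
  proof (rule softmax_cong[where c = "- (\<Sum>k\<in>nbhd E i. \<omega> i k * c k)"])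
    fix j
    have vd: "vln (vdiv (softmax (u k)) (W $ i)) $ j = u k $ j - c k - vln (W $ i) $ j" for k
      using pos[of i j] softmax_pos[of "u k" j] vln_softmax[of "u k" j]
      by (simp add: vln_def vdiv_def ln_div c_def)
    \<comment> \<open>Since the weights sum to one, the last term is \<open>vln (W $ i) $ j\<close>,
      which cancels the base point of \<open>lift_map\<close>.\<close>
    have "(\<Sum>k\<in>nbhd E i. \<omega> i k * (u k $ j - c k - vln (W $ i) $ j))
        = (\<Sum>k\<in>nbhd E i. \<omega> i k * u k $ j) - (\<Sum>k\<in>nbhd E i. \<omega> i k * c k)
          - (\<Sum>k\<in>nbhd E i. \<omega> i k) * vln (W $ i) $ j"
      by (simp add: algebra_simps sum_subtractf sum.distrib sum_distrib_left)
    then show "(vln (W $ i) + (\<Sum>k\<in>nbhd E i. \<omega> i k *\<^sub>R vln (vdiv (softmax (u k)) (W $ i)))) $ j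
        = logits \<rho> D (avg_matrix E \<omega>) W $ i $ j + - (\<Sum>k\<in>nbhd E i. \<omega> i k * c k)"
      by (simp add: vd logits_def avg_matrix_mult sum flip: u_def)
  qed
  finally show ?thesis .
qed

section \<open>Logarithmic derivatives along replicator flows\<close>

lemma has_vector_derivative_matrix_iff:
  fixes X :: "real \<Rightarrow> real ^ 'c ^ 'n"
  shows "(X has_vector_derivative X') (at t within T) \<longleftrightarrow>
    (\<forall>i j. ((\<lambda>s. X s $ i $ j) has_real_derivative X' $ i $ j) (at t within T))"
proof -
  have "(X has_vector_derivative X') (at t within T) \<longleftrightarrow>
      (\<forall>b\<in>Basis. ((\<lambda>s. X s \<bullet> b) has_derivative (\<lambda>h. h *\<^sub>R X' \<bullet> b)) (at t within T))"
    unfolding has_vector_derivative_def by (rule has_derivative_componentwise_within)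
  then show ?thesis
    by (auto simp: Basis_vec_def inner_axis has_field_derivative_def mult_commute_abs)
qed

lemma has_vector_derivative_replicator_iff:
  fixes W :: "real \<Rightarrow> real ^ 'c ^ 'n"
  shows "(W has_vector_derivative replicator_rows P X) (at t within T) \<longleftrightarrow>
    (\<forall>i j. ((\<lambda>s. W s $ i $ j) has_real_derivative P $ i $ j * (X $ i $ j - P $ i \<bullet> X $ i))
      (at t within T))"
  by (simp add: has_vector_derivative_matrix_iff replicator_rows_def replicator_mult)

text \<open>The factor \<open>W t $ i $ j\<close> of the replicator field cancels against the
  derivative of the logarithm. What is subtracted from \<open>X $ i $ j\<close> is the same for all
  columns \<open>j\<close>.\<close>

lemma replicator_vln_derivative:
  fixes W :: "real \<Rightarrow> real ^ 'c ^ 'n"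
  assumes "(W has_vector_derivative replicator_rows (W t) X) (at t within T)"
    and "W t \<in> assignment_manifold"
  shows "((\<lambda>s. vln (W s $ i) $ j) has_real_derivative X $ i $ j - W t $ i \<bullet> X $ i) (at t within T)"
proof -
  have pos: "W t $ i $ j > 0"
    using assms(2) by (simp add: assignment_manifold_def simplex_interior_def)
  have "((\<lambda>s. W s $ i $ j) has_real_derivative W t $ i $ j * (X $ i $ j - W t $ i \<bullet> X $ i))
      (at t within T)"
    using assms(1) by (simp add: has_vector_derivative_replicator_iff)
  from DERIV_chain'[OF this DERIV_ln[OF pos]] pos show ?thesis
    by (simp add: vln_def flip: mult.assoc)
qed

text \<open>Averaging with \<open>\<Omega>\<close> is linear and the distance term is constant in
  time. The subtracted sum is again independent of the column \<open>j\<close>.\<close>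

lemma logits_derivative:
  fixes W :: "real \<Rightarrow> real ^ 'c ^ 'n::finite"
  assumes "(W has_vector_derivative replicator_rows (W t) X) (at t within T)"
    and "W t \<in> assignment_manifold"
  shows "((\<lambda>s. logits \<rho> D \<Omega> (W s) $ i $ j) has_real_derivative
    (\<Omega> ** X) $ i $ j - (\<Sum>k\<in>UNIV. \<Omega> $ i $ k * (W t $ k \<bullet> X $ k))) (at t within T)"
proof -
  have "((\<lambda>s. \<Sum>k\<in>UNIV. \<Omega> $ i $ k * (vln (W s $ k) $ j - (1 / \<rho>) * D k $ j)) has_real_derivative
      (\<Sum>k\<in>UNIV. \<Omega> $ i $ k * (X $ k $ j - W t $ k \<bullet> X $ k))) (at t within T)"
    by (auto intro!: derivative_eq_intros replicator_vln_derivative[OF assms] sum.cong)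
  then show ?thesis
    by (simp add: logits_def matrix_matrix_mult_def sum_subtractf right_diff_distrib)
qed

text \<open>The shift \<open>c\<close> drops out because softmax is invariant under adding constants.\<close>

lemma softmax_derivative:
  fixes v :: "real \<Rightarrow> real ^ 'c"
  assumes "\<And>j. ((\<lambda>s. v s $ j) has_real_derivative u $ j - c) (at t within T)"
  shows "((\<lambda>s. softmax (v s) $ j) has_real_derivative
    softmax (v t) $ j * (u $ j - softmax (v t) \<bullet> u)) (at t within T)"
proof -
  define Z where "Z s = (\<Sum>l\<in>UNIV. exp (v s $ l))" for s
  have Z: "Z t > 0"
    unfolding Z_def by (rule sum_exp_pos)
  have e: "((\<lambda>s. exp (v s $ l)) has_real_derivative exp (v t $ l) * (u $ l - c)) (at t within T)" for l
    using assms[of l] by (auto intro!: derivative_eq_intros)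
  define m where "m = (\<Sum>l\<in>UNIV. exp (v t $ l) * u $ l)"
  have "(Z has_real_derivative (\<Sum>l\<in>UNIV. exp (v t $ l) * (u $ l - c))) (at t within T)"
    unfolding Z_def by (intro DERIV_sum e)
  moreover have "(\<Sum>l\<in>UNIV. exp (v t $ l) * (u $ l - c)) = m - c * Z t"
    by (simp add: m_def Z_def algebra_simps sum_subtractf sum_distrib_left)
  ultimately have "(Z has_real_derivative m - c * Z t) (at t within T)"
    by simp
  from DERIV_divide[OF e this] Z
  have "((\<lambda>s. exp (v s $ j) / Z s) has_real_derivative
      (exp (v t $ j) * (u $ j - c) * Z t - exp (v t $ j) * (m - c * Z t)) / (Z t * Z t)) (at t within T)"
    by simp
  moreover have "softmax (v t) \<bullet> u = m / Z t"
    by (simp add: softmax_def inner_vec_def Z_def m_def sum_divide_distrib)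
  \<comment> \<open>The contribution of \<open>c\<close> to the numerator's derivative cancels
    against its contribution to the derivative of \<open>Z\<close>.\<close>
  moreover have "(exp (v t $ j) * (u $ j - c) * Z t - exp (v t $ j) * (m - c * Z t)) / (Z t * Z t)
      = exp (v t $ j) / Z t * (u $ j - m / Z t)"
    using Z by (simp add: field_simps)
  ultimately show ?thesis
    by (simp add: softmax_def Z_def)
qed

theorem proposition3p5:
  fixes F :: "'f set" and d :: "'f \<Rightarrow> 'f \<Rightarrow> real"
    and f :: "'n::finite \<Rightarrow> 'f" and fstar :: "'c::finite \<Rightarrow> 'f"
    and \<rho> :: real
    and E :: "('n \<times> 'n) set" and \<omega> :: "'n \<Rightarrow> 'n \<Rightarrow> real"
    and T :: "real set"
    and S :: "real ^ 'c ^ 'n \<Rightarrow> real ^ 'c ^ 'n"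
  assumes "Metric_space F d"
    and "\<And>i. f i \<in> F" and "\<And>j. fstar j \<in> F"
    and "\<rho> > 0"
    and "sym E"
    and "\<And>i k. k \<in> nbhd E i \<Longrightarrow> \<omega> i k > 0"
    and "\<And>i. (\<Sum>k\<in>nbhd E i. \<omega> i k) = 1"
    and "is_interval T" and "0 \<in> T"
  defines "S \<equiv> similarity \<rho> (dist_vec d f fstar) E \<omega>"
  shows "(\<forall>W. assignment_flow_on T S W \<longrightarrow>
            S_flow_system_on T S (avg_matrix E \<omega>) W (\<lambda>t. S (W t))) \<and>
         (\<forall>W Sbar. S_flow_system_on T S (avg_matrix E \<omega>) W Sbar \<longrightarrow>
            assignment_flow_on T S W \<and> (\<forall>t\<in>T. Sbar t = S (W t)))"
proof (intro conjI allI impI ballI)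
  let ?\<Omega> = "avg_matrix E \<omega>"
  define A :: "real ^ 'c ^ 'n \<Rightarrow> real ^ 'c ^ 'n" where "A = logits \<rho> (dist_vec d f fstar) ?\<Omega>"
  \<comment> \<open>This is the row constant of \<open>logits_derivative\<close>: it serves as
    \<open>c\<close> in \<open>softmax_derivative\<close> and cancels in differences of
    entries.\<close>
  define b where "b W X i = (\<Sum>k\<in>UNIV. ?\<Omega> $ i $ k * (W $ k \<bullet> X $ k))" for W X :: "real ^ 'c ^ 'n" and i
  have S: "S W $ i = softmax (A W $ i)" if "W \<in> assignment_manifold" for W i
    unfolding S_def A_def using that assms(7) by (rule similarity_softmax)
  have A: "((\<lambda>s. A (W s) $ i $ j) has_real_derivative (?\<Omega> ** X) $ i $ j - b (W t) X i) (at t within T)"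
    if "(W has_vector_derivative replicator_rows (W t) X) (at t within T)"
      and "W t \<in> assignment_manifold" for W X t i j
    unfolding A_def b_def using that by (rule logits_derivative)
  {
    fix W
    assume flow: "assignment_flow_on T S W"
    have W: "W t \<in> assignment_manifold"
        "(W has_vector_derivative replicator_rows (W t) (S (W t))) (at t within T)" if "t \<in> T" for t
      using flow that by (auto simp: assignment_flow_on_def)
    have "((\<lambda>t. S (W t)) has_vector_derivative replicator_rows (S (W t)) (?\<Omega> ** S (W t))) (at t within T)"
      if t: "t \<in> T" for t
      unfolding has_vector_derivative_replicator_iff
    proof (intro allI)
      fix i j
      have "((\<lambda>s. softmax (A (W s) $ i) $ j) has_real_derivative
          softmax (A (W t) $ i) $ j * ((?\<Omega> ** S (W t)) $ i $ j - softmax (A (W t) $ i) \<bullet> (?\<Omega> ** S (W t)) $ i))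
          (at t within T)"
        using A[OF W(2,1)[OF t]] by (rule softmax_derivative)
      then show "((\<lambda>s. S (W s) $ i $ j) has_real_derivative
          S (W t) $ i $ j * ((?\<Omega> ** S (W t)) $ i $ j - S (W t) $ i \<bullet> (?\<Omega> ** S (W t)) $ i)) (at t within T)"
        unfolding S[OF W(1)[OF t]]
        \<comment> \<open>The softmax form of \<open>S (W s)\<close> is known for times
          \<open>s\<close> in \<open>T\<close> only, which suffices for a derivative within
          \<open>T\<close>; the radius one is arbitrary.\<close>
        by (rule has_field_derivative_transform_within[OF _ zero_less_one t]) (simp add: S W(1))
    qed
    moreover have "S (W t) \<in> assignment_manifold" if "t \<in> T" for t
      by (simp add: assignment_manifold_def S[OF W(1)[OF that]] softmax_in_simplex)
    ultimately show "S_flow_system_on T S ?\<Omega> W (\<lambda>t. S (W t))"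
      using flow by (simp add: S_flow_system_on_def assignment_flow_on_def)
  }
  have main: "Sbar t = S (W t)" if sys: "S_flow_system_on T S ?\<Omega> W Sbar" and t: "t \<in> T" for W Sbar t
  proof -
    have W: "W t \<in> assignment_manifold" "Sbar t \<in> assignment_manifold"
        "(W has_vector_derivative replicator_rows (W t) (Sbar t)) (at t within T)"
        "(Sbar has_vector_derivative replicator_rows (Sbar t) (?\<Omega> ** Sbar t)) (at t within T)"
      if "t \<in> T" for t
      using sys that by (auto simp: S_flow_system_on_def)
    have init: "Sbar 0 = S (W 0)"
      using sys by (simp add: S_flow_system_on_def)
    have "Sbar t $ i = softmax (A (W t) $ i)" for i
    proof -
      define g where "g s j = vln (Sbar s $ i) $ j - A (W s) $ i $ j" for s j
      \<comment> \<open>Any fixed reference column would do.\<close>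
      define l :: 'c where "l = undefined"
      \<comment> \<open>The entries of \<open>?\<Omega> ** Sbar s\<close> cancel, so the derivative
        of \<open>g s j\<close> does not depend on \<open>j\<close>.\<close>
      have row: "((\<lambda>s. g s j) has_real_derivative b (W s) (Sbar s) i - Sbar s $ i \<bullet> (?\<Omega> ** Sbar s) $ i)
          (at s within T)" if "s \<in> T" for s j
        using DERIV_diff[OF replicator_vln_derivative[OF W(4,2)[OF that]] A[OF W(3,1)[OF that]], of i j i j]
        by (simp add: g_def)
      have g: "((\<lambda>s. g s j - g s l) has_real_derivative 0) (at s within T)" if "s \<in> T" for s j
        using DERIV_diff[OF row[OF that, of j] row[OF that, of l]] by simp
      have "vln (Sbar t $ i) $ j = A (W t) $ i $ j + g t l" for j
      proof -
        have "convex T"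
          using assms(8) by (simp add: is_interval_convex)
        \<comment> \<open>On the convex set \<open>T\<close>, a vanishing derivative within
          \<open>T\<close> makes the difference constant, up to the endpoints.\<close>
        from has_field_derivative_zero_constant[OF this g[of _ j]] obtain c
          where c: "\<And>s. s \<in> T \<Longrightarrow> g s j - g s l = c"
          by blast
        \<comment> \<open>Initially \<open>Sbar\<close> is the softmax of the logits, so
          \<open>g 0 j\<close> is minus the log normalizer, whatever \<open>j\<close> is.\<close>
        have "g 0 j - g 0 l = 0"
          by (simp add: g_def init S[OF W(1)[OF assms(9)]] vln_softmax)
        then have "g t j - g t l = 0"
          using c[OF t] c[OF assms(9)] by linarith
        then show ?thesis
          using g_def[of t j] by linarith
      qed
      moreover have "Sbar t $ i \<in> simplex_interior"
        using W(2)[OF t] by (simp add: assignment_manifold_def)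
      ultimately show ?thesis
        by (rule softmax_eqI[rotated])
    qed
    then show ?thesis
      by (simp add: vec_eq_iff S[OF W(1)[OF t]])
  qed
  show "Sbar t = S (W t)" if "S_flow_system_on T S ?\<Omega> W Sbar" "t \<in> T" for W Sbar t
    using that by (rule main)
  \<comment> \<open>Inserting \<open>Sbar t = S (W t)\<close> into the first equation of the system
    gives the flow.\<close>
  show "assignment_flow_on T S W" if sys: "S_flow_system_on T S ?\<Omega> W Sbar" for W Sbar
    using sys main[OF sys] by (simp add: S_flow_system_on_def assignment_flow_on_def)
qed

end
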